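(* Let $s,n\ge 1$ be integers, let $(a_{ij})_{1\le i,j\le s}$ be the real coefficient matrix of an $s$-stage symplectic implicit Runge-Kutta scheme, let $W_0\in\mathfrak{gl}(n)$, and let $B:\mathfrak{gl}(n)\to\mathfrak{gl}(n)$ be linear. Let $\mathbf{A},\mathbf{W}_0,\mathbf{Id}\in\mathfrak{gl}(sn)$ and $\mathbf{B}:\mathfrak{gl}(sn)\to\mathfrak{gl}(sn)$ be the associated block matrices and block map defined in the context. Let $\epsilon>0$ and let $V_{\mathbf{W}_0}\subset\mathfrak{gl}(sn)$ be an open neighborhood of $\mathbf{W}_0$ such that for every $h\in(-\epsilon,\epsilon)$ the equation $$\mathbf{W}_0=\left(\mathbf{Id}-h\,\mathbf{A}\,\mathbf{B}(\mathbf{X})\right)\mathbf{X}\left(\mathbf{Id}+h\,\mathbf{B}(\mathbf{X})\,\mathbf{A}^T\right)\qquad(\ast)$$ has a unique solution $\mathbf{X}\in V_{\mathbf{W}_0}$. Set $$G(h,\mathbf{X})=\left(\mathbf{Id}-h\,\mathbf{A}\,\mathbf{B}(\mathbf{X})\right)\mathbf{X}\left(\mathbf{Id}+h\,\mathbf{B}(\mathbf{X})\,\mathbf{A}^T\right)-\mathbf{W}_0 .$$ Then there is $\delta\in(0,\epsilon]$ such that for each fixed $h$ with $|h|<\delta$ there is an open neighborhood of $\mathbf{W}_0$ contained in $V_{\mathbf{W}_0}$ on which the map $$C(\mathbf{X})=\mathbf{X}-G(h,\mathbf{X})$$ is a contraction. In particular, for each such $h$, a solution of $(\ast)$ is obtained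 by iterating $C$ starting with the initial condition $\mathbf{W}_0$; that is, the sequence $\mathbf{X}_0=\mathbf{W}_0$, $\mathbf{X}_{k+1}=C(\mathbf{X}_k)$ converges to a solution of $(\ast)$.
   Context: $\mathfrak{gl}(m)$ denotes the space of real $m\times m$ matrices, equipped with the Frobenius norm. Matrices in $\mathfrak{gl}(sn)$ are viewed as $s\times s$ block matrices with $n\times n$ blocks. A map is a contraction on a set if it is Lipschitz there with Lipschitz constant strictly less than $1$. An $s$-stage Runge-Kutta scheme has real coefficients $a_{ij}$, $b_i$ ($1\le i,j\le s$); it is symplectic if $b_ia_{ij}+b_ja_{ji}=b_ib_j$ for all $i,j$. Definitions of the block objects: - $\mathbf{A}\in\mathfrak{gl}(sn)$ is the block matrix whose $(i,j)$ block is $a_{ij}\mathrm{Id}$, with $\mathrm{Id}$ the $n\times n$ identity. - $\mathbf{Id}$ is the $sn\times sn$ identity matrix. - $\mathbf{W}_0\in\mathfrak{gl}(sn)$ is the block matrix all of whose $s^2$ blocks equal $W_0$. (It arises as $\mathbf{g}_0^\dagger\mathbf{p}_0$, where $\mathbf{g}_0=(g_0\ \cdots\ g_0)$ and $\mathbf{p}_0=(p_0\ \cdots\ p_0)$ are $n\times sn$ block rows, $W_0=g_0^\dagger p_0$, and $\dagger$ is conjugate transposition.) - For $\mathbf{X}\in\mathfrak{gl}(sn)$, $X_i\in\mathfrak{gl}(n)$ denotes its $i$-th diagonal $n\times n$ block, and $\mathbf{B}(\mathbf{X})$ is the block diagonal matrix with diagonal blocks $B(X_1),\ldots,B(X_s)$.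 *)

theory Defs
  imports "HOL-Analysis.Analysis"
begin

definition symplectic_rk :: "real^'s^'s \<Rightarrow> real^'s \<Rightarrow> bool" where
  "symplectic_rk a b \<longleftrightarrow> (\<forall>i j. b $ i * a $ i $ j + b $ j * a $ j $ i = b $ i * b $ j)"

text \<open>
  An \<open>sn \<times> sn\<close> matrix is indexed by pairs \<open>(i, k)\<close>, where \<open>i\<close> is the block index and \<open>k\<close> the
  position inside the block. The type-class norm on such matrices is the Frobenius norm:
\<close>

lemma norm_eq_frobenius:
  fixes X :: "real^'m^'m"
  shows "norm X = sqrt (\<Sum>p\<in>UNIV. \<Sum>q\<in>UNIV. (X $ p $ q)\<^sup>2)"
  by (simp add: norm_vec_def L2_set_def sum_nonneg)

definition block_matrix :: "('s::finite \<Rightarrow> 's \<Rightarrow> real^'n^'n) \<Rightarrow> real^('s::finite \<times> 'n::finite)^('s \<times> 'n)" where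
  "block_matrix M = (\<chi> p q. M (fst p) (fst q) $ snd p $ snd q)"

definition diag_block :: "real^('s::finite \<times> 'n::finite)^('s \<times> 'n) \<Rightarrow> 's \<Rightarrow> real^'n^'n" where
  "diag_block X i = (\<chi> k l. X $ (i, k) $ (i, l))"

definition block_A :: "real^'s^'s \<Rightarrow> real^('s::finite \<times> 'n::finite)^('s \<times> 'n)" where
  "block_A a = block_matrix (\<lambda>i j. a $ i $ j *\<^sub>R mat 1)"

definition block_W :: "real^'n^'n \<Rightarrow> real^('s::finite \<times> 'n::finite)^('s \<times> 'n)" where
  "block_W W0 = block_matrix (\<lambda>i j. W0)"

definition block_B ::
  "(real^'n^'n \<Rightarrow> real^'n^'n) \<Rightarrow> real^('s::finite \<times> 'n::finite)^('s \<times> 'n) \<Rightarrow> real^('s::finite \<times> 'n::finite)^('s \<times> 'n)" where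
  "block_B B X = block_matrix (\<lambda>i j. if i = j then B (diag_block X i) else 0)"

definition stage_map ::
  "real^'s^'s \<Rightarrow> (real^'n^'n \<Rightarrow> real^'n^'n) \<Rightarrow> real \<Rightarrow>
   real^('s::finite \<times> 'n::finite)^('s \<times> 'n) \<Rightarrow> real^('s::finite \<times> 'n::finite)^('s \<times> 'n)" where
  "stage_map a B h X =
     (mat 1 - h *\<^sub>R (block_A a ** block_B B X)) ** X **
     (mat 1 + h *\<^sub>R (block_B B X ** transpose (block_A a)))"

definition stage_residual ::
  "real^'s^'s \<Rightarrow> (real^'n^'n \<Rightarrow> real^'n^'n) \<Rightarrow> real^'n^'n \<Rightarrow> real \<Rightarrow>
   real^('s::finite \<times> 'n::finite)^('s \<times> 'n) \<Rightarrow> real^('s::finite \<times> 'n::finite)^('s \<times> 'n)" where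
  "stage_residual a B W0 h X = stage_map a B h X - block_W W0"

definition stage_iteration ::
  "real^'s^'s \<Rightarrow> (real^'n^'n \<Rightarrow> real^'n^'n) \<Rightarrow> real^'n^'n \<Rightarrow> real \<Rightarrow>
   real^('s::finite \<times> 'n::finite)^('s \<times> 'n) \<Rightarrow> real^('s::finite \<times> 'n::finite)^('s \<times> 'n)" where
  "stage_iteration a B W0 h X = X - stage_residual a B W0 h X"

definition contraction_on :: "'a::metric_space set \<Rightarrow> ('a \<Rightarrow> 'b::metric_space) \<Rightarrow> bool" where
  "contraction_on U f \<longleftrightarrow> (\<exists>L<1. L-lipschitz_on U f)"

end

theory Submission
  imports Defs
begin

text \<open>
  Expanding the two factors of the stage map gives
  \<open>C(X) = W\<^sub>0 + h (P(X) + h Q(X))\<close>, where \<open>P(X) = A B(X) X - X B(X) A\<^sup>T\<close> and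
  \<open>Q(X) = A B(X) X B(X) A\<^sup>T\<close>: the identity parts of \<open>X\<close> and \<open>G(h, X)\<close> cancel. Since \<open>P\<close> and \<open>Q\<close>
  are polynomial in the entries of \<open>X\<close>, they are Lipschitz on every bounded set, and therefore
  on a closed ball around \<open>W\<^sub>0\<close> inside \<open>V\<close>. The factor \<open>h\<close> in front makes the Lipschitz constant
  of \<open>C\<close>, and also the displacement of the centre, as small as desired. So for small \<open>h\<close> the map
  \<open>C\<close> is a contraction that sends the ball to itself, and the Banach fixed point theorem yields
  the limit of the iterates. A fixed point of \<open>C\<close> is a zero of \<open>G(h, \<sqdot>)\<close>.

  The contraction statement is \<open>small_perturbation_of_constant\<close>; the Lipschitz bounds on \<open>P\<close> and
  \<open>Q\<close> come from \<open>bounded_bilinear_lipschitz_on_bounded\<close>.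
\<close>

lemma bounded_lipschitz_image:
  fixes f :: "'a::metric_space \<Rightarrow> 'b::metric_space"
  assumes lip: "L-lipschitz_on S f" and "bounded S"
  shows "bounded (f ` S)"
proof (cases "S = {}")
  case False
  then obtain y where y: "y \<in> S" by blast
  obtain e where e: "\<And>x. x \<in> S \<Longrightarrow> dist y x \<le> e"
    using \<open>bounded S\<close> bounded_any_center[of S y] by blast
  have "dist (f y) (f x) \<le> L * e" if "x \<in> S" for x
    using lipschitz_onD[OF lip y that] mult_left_mono[OF e[OF that] lipschitz_on_nonneg[OF lip]]
    by linarith
  then show ?thesis
    unfolding bounded_def by blast
qed simp

text \<open>
  The usual identity \<open>f x g x - f y g y = (f x - f y) g x + f y (g x - g y)\<close>: a product of
  Lipschitz maps is Lipschitz as soon as both factors are bounded, which boundedness of the domain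
  guarantees.
\<close>

lemma bounded_bilinear_lipschitz_on_bounded:
  fixes S :: "'d::metric_space set"
  assumes "bounded_bilinear bop" and "bounded S"
    and f: "\<exists>L. L-lipschitz_on S f" and g: "\<exists>L. L-lipschitz_on S g"
  shows "\<exists>L. L-lipschitz_on S (\<lambda>x. bop (f x) (g x))"
proof -
  interpret bounded_bilinear bop by fact
  obtain Lf Lg where Lf: "Lf-lipschitz_on S f" and Lg: "Lg-lipschitz_on S g"
    using f g by blast
  obtain Mf where Mf: "Mf > 0" "\<And>x. x \<in> S \<Longrightarrow> norm (f x) \<le> Mf"
    using bounded_lipschitz_image[OF Lf \<open>bounded S\<close>] by (auto simp: bounded_pos)
  obtain Mg where Mg: "Mg > 0" "\<And>x. x \<in> S \<Longrightarrow> norm (g x) \<le> Mg"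
    using bounded_lipschitz_image[OF Lg \<open>bounded S\<close>] by (auto simp: bounded_pos)
  obtain K where K: "K > 0" "\<And>u v. norm (bop u v) \<le> norm u * norm v * K"
    using pos_bounded by blast
  have nonneg: "Lf \<ge> 0" "Lg \<ge> 0"
    using Lf Lg lipschitz_on_nonneg by blast+
  have "((Lf * Mg + Mf * Lg) * K)-lipschitz_on S (\<lambda>x. bop (f x) (g x))"
  proof (rule lipschitz_onI)
    fix x y assume x: "x \<in> S" and y: "y \<in> S"
    have "norm (bop (f x) (g x) - bop (f y) (g y))
        = norm (bop (f x - f y) (g x) + bop (f y) (g x - g y))"
      by (simp add: diff_left diff_right)
    also have "\<dots> \<le> norm (f x - f y) * norm (g x) * K + norm (f y) * norm (g x - g y) * K"
      by (intro norm_triangle_mono K)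
    also have "\<dots> \<le> (Lf * dist x y) * Mg * K + Mf * (Lg * dist x y) * K"
      using K(1) Mf Mg x y nonneg lipschitz_onD[OF Lf x y] lipschitz_onD[OF Lg x y]
      by (intro add_mono mult_right_mono mult_mono) (auto simp: dist_norm intro: less_imp_le)
    also have "\<dots> = (Lf * Mg + Mf * Lg) * K * dist x y"
      by (simp add: algebra_simps)
    finally show "dist (bop (f x) (g x)) (bop (f y) (g y)) \<le> (Lf * Mg + Mf * Lg) * K * dist x y"
      by (simp add: dist_norm)
  next
    show "0 \<le> (Lf * Mg + Mf * Lg) * K"
      using K(1) Mf(1) Mg(1) nonneg by simp
  qed
  then show ?thesis ..
qed

text \<open>
  Each step shrinks the distance to the Banach fixed point by the factor \<open>c\<close>, so that the distance
  of the iterates to it decays like \<open>c ^ k\<close>.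
\<close>

lemma contraction_iterates_converge:
  fixes f :: "'a::metric_space \<Rightarrow> 'a"
  assumes "complete S" and x0: "x0 \<in> S" and self: "f ` S \<subseteq> S"
    and lip: "c-lipschitz_on S f" and "c < 1"
  shows "\<exists>x\<in>S. f x = x \<and> (\<lambda>k. (f ^^ k) x0) \<longlonglongrightarrow> x"
proof -
  have c: "0 \<le> c" using lip by (rule lipschitz_on_nonneg)
  have "S \<noteq> {}" using x0 by blast
  have "\<exists>!x\<in>S. f x = x"
    using lipschitz_onD[OF lip] by (intro Banach_fix[OF \<open>complete S\<close> \<open>S \<noteq> {}\<close> c \<open>c < 1\<close> self]) blast
  then obtain x where x: "x \<in> S" "f x = x" by blast
  have iterate: "(f ^^ k) x0 \<in> S \<and> dist ((f ^^ k) x0) x \<le> c ^ k * dist x0 x" for k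
  proof (induction k)
    case (Suc k)
    have "dist (f ((f ^^ k) x0)) (f x) \<le> c * dist ((f ^^ k) x0) x"
      using Suc x by (intro lipschitz_onD[OF lip]) auto
    also have "\<dots> \<le> c * (c ^ k * dist x0 x)"
      using Suc c by (intro mult_left_mono) auto
    finally show ?case
      using Suc x self by auto
  qed (simp add: x0)
  have "(\<lambda>k. c ^ k * dist x0 x) \<longlonglongrightarrow> 0 * dist x0 x"
    using c \<open>c < 1\<close> by (intro tendsto_intros LIMSEQ_power_zero) auto
  then have "(\<lambda>k. dist ((f ^^ k) x0) x) \<longlonglongrightarrow> 0"
    using iterate by - (rule Lim_null_comparison[where g = "\<lambda>k. c ^ k * dist x0 x"], simp_all)
  then have "(\<lambda>k. (f ^^ k) x0) \<longlonglongrightarrow> x"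
    by (subst tendsto_dist_iff)
  with x show ?thesis by blast
qed

text \<open>
  For \<open>\<bar>h\<bar> \<le> 1\<close> the bracket \<open>P x + h Q x\<close> has a Lipschitz constant \<open>L\<close> and a bound \<open>c\<close> at the centre
  that do not depend on \<open>h\<close>. The ball of radius \<open>r\<close> is mapped to itself once
  \<open>\<bar>h\<bar> (L r + c) \<le> r\<close>, so \<open>\<bar>h\<bar> L \<le> 1/2\<close> and \<open>\<bar>h\<bar> c \<le> r/2\<close> are enough.
\<close>

lemma small_perturbation_of_constant:
  fixes P Q :: "'a::real_normed_vector \<Rightarrow> 'a"
  assumes "r > 0"
    and P: "\<exists>L. L-lipschitz_on (cball w r) P" and Q: "\<exists>L. L-lipschitz_on (cball w r) Q"
  shows "\<exists>\<delta>>0. \<forall>h. \<bar>h\<bar> < \<delta> \<longrightarrow>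
    (1/2)-lipschitz_on (cball w r) (\<lambda>x. w + h *\<^sub>R (P x + h *\<^sub>R Q x)) \<and>
    (\<lambda>x. w + h *\<^sub>R (P x + h *\<^sub>R Q x)) ` cball w r \<subseteq> cball w r"
proof -
  obtain LP LQ where LP: "LP-lipschitz_on (cball w r) P" and LQ: "LQ-lipschitz_on (cball w r) Q"
    using P Q by blast
  define L where "L = LP + LQ"
  define c where "c = norm (P w) + norm (Q w)"
  have L: "L \<ge> 0" and c: "c \<ge> 0"
    using lipschitz_on_nonneg[OF LP] lipschitz_on_nonneg[OF LQ] by (simp_all add: L_def c_def)
  \<comment> \<open>Each denominator is shifted by one because \<open>L\<close> and \<open>c\<close> may vanish.\<close>
  define \<delta> where "\<delta> = min 1 (min (1 / (2 * (L + 1))) (r / (2 * (c + 1))))"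
  have "\<delta> > 0"
    using L c \<open>r > 0\<close> by (simp add: \<delta>_def)
  moreover have "(1/2)-lipschitz_on (cball w r) F \<and> F ` cball w r \<subseteq> cball w r"
    if "\<bar>h\<bar> < \<delta>" and F: "F = (\<lambda>x. w + h *\<^sub>R (P x + h *\<^sub>R Q x))" for h F
  proof -
    have h: "\<bar>h\<bar> \<le> 1" "\<bar>h\<bar> \<le> 1 / (2 * (L + 1))" "\<bar>h\<bar> \<le> r / (2 * (c + 1))"
      using that by (auto simp: \<delta>_def)
    have "\<bar>h\<bar> * (L + 1) \<le> 1/2" and "\<bar>h\<bar> * (c + 1) \<le> r/2"
      using h(2,3) L c by (simp_all add: field_simps)
    moreover have "\<bar>h\<bar> * L \<le> \<bar>h\<bar> * (L + 1)" and "\<bar>h\<bar> * c \<le> \<bar>h\<bar> * (c + 1)"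
      by (simp_all add: mult_left_mono)
    ultimately have hL: "\<bar>h\<bar> * L \<le> 1/2" and hc: "\<bar>h\<bar> * c \<le> r/2"
      by linarith+
    have "(\<bar>h\<bar> * (LP + \<bar>h\<bar> * LQ))-lipschitz_on (cball w r) (\<lambda>x. h *\<^sub>R (P x + h *\<^sub>R Q x))"
      by (intro lipschitz_intros LP LQ)
    then have "(0 + \<bar>h\<bar> * (LP + \<bar>h\<bar> * LQ))-lipschitz_on (cball w r) F"
      unfolding F by (intro lipschitz_on_add lipschitz_on_constant)
    moreover have "\<bar>h\<bar> * (LP + \<bar>h\<bar> * LQ) \<le> \<bar>h\<bar> * L"
      unfolding L_def using h(1) lipschitz_on_nonneg[OF LQ]
      by (intro mult_left_mono add_left_mono mult_left_le_one_le) auto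
    ultimately have lip: "(1/2)-lipschitz_on (cball w r) F"
      using hL by (auto intro: lipschitz_on_mono)
    have "norm (P w + h *\<^sub>R Q w) \<le> c"
    proof -
      have "norm (P w + h *\<^sub>R Q w) \<le> norm (P w) + \<bar>h\<bar> * norm (Q w)"
        by (metis norm_scaleR norm_triangle_ineq)
      also have "\<dots> \<le> c"
        using h(1) by (simp add: c_def mult_left_le_one_le)
      finally show ?thesis .
    qed
    then have "\<bar>h\<bar> * norm (P w + h *\<^sub>R Q w) \<le> \<bar>h\<bar> * c"
      by (simp add: mult_left_mono)
    then have centre: "dist w (F w) \<le> r/2"
      using hc by (simp add: F dist_norm)
    have "F x \<in> cball w r" if "x \<in> cball w r" for x
    proof -
      have "dist (F w) (F x) \<le> 1/2 * dist w x"
        using that \<open>r > 0\<close> by (intro lipschitz_onD[OF lip]) auto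
      moreover have "dist w x \<le> r"
        using that by simp
      ultimately have "dist w (F x) \<le> r"
        using centre dist_triangle[of w "F x" "F w"] by linarith
      then show ?thesis by simp
    qed
    with lip show ?thesis by blast
  qed
  ultimately show ?thesis by blast
qed

lemma bounded_bilinear_matrix_matrix_mult:
  "bounded_bilinear ((**) :: real^'n::finite^'m::finite \<Rightarrow> real^'p::finite^'n \<Rightarrow> real^'p^'m)"
  unfolding bilinear_conv_bounded_bilinear[symmetric] bilinear_def
proof (intro allI conjI linearI)
  fix X Y :: "real^'n^'m" and Z U :: "real^'p^'n" and c :: real
  show "X ** (Z + U) = X ** Z + X ** U"
    by (rule matrix_add_ldistrib)
  show "(X + Y) ** Z = X ** Z + Y ** Z"
    by (simp add: vec_eq_iff matrix_matrix_mult_def sum.distrib distrib_right)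
  show "X ** (c *\<^sub>R Z) = c *\<^sub>R (X ** Z)"
    by (simp add: vec_eq_iff matrix_matrix_mult_def sum_distrib_left mult.left_commute)
  show "(c *\<^sub>R X) ** Z = c *\<^sub>R (X ** Z)"
    by (simp add: vec_eq_iff matrix_matrix_mult_def sum_distrib_left mult.assoc)
qed

lemma linear_block_B:
  fixes B :: "real^'n::finite^'n \<Rightarrow> real^'n^'n"
  assumes "linear B"
  shows "linear (block_B B :: real^('s::finite \<times> 'n)^('s \<times> 'n) \<Rightarrow> _)"
proof (rule linearI)
  interpret linear B by fact
  fix X Y :: "real^('s \<times> 'n)^('s \<times> 'n)" and c :: real
  have "diag_block (X + Y) i = diag_block X i + diag_block Y i" for i
    by (simp add: diag_block_def vec_eq_iff)
  then show "block_B B (X + Y) = block_B B X + block_B B Y"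
    by (simp add: block_B_def block_matrix_def add vec_eq_iff[of "vec_lambda _"])
  have "diag_block (c *\<^sub>R X) i = c *\<^sub>R diag_block X i" for i
    by (simp add: diag_block_def vec_eq_iff)
  then show "block_B B (c *\<^sub>R X) = c *\<^sub>R block_B B X"
    by (simp add: block_B_def block_matrix_def scale vec_eq_iff[of "vec_lambda _"])
qed

text \<open>The term \<open>X\<close> cancels, which exhibits the iteration as an \<open>O(h)\<close> perturbation of a constant.\<close>

lemma stage_iteration_expand:
  fixes a :: "real^'s::finite^'s" and B :: "real^'n::finite^'n \<Rightarrow> real^'n^'n"
    and X :: "real^('s \<times> 'n)^('s \<times> 'n)"
  defines "M \<equiv> block_A a ** block_B B X" and "N \<equiv> block_B B X ** transpose (block_A a)"
  shows "stage_iteration a B W0 h X = block_W W0 + h *\<^sub>R ((M ** X - X ** N) + h *\<^sub>R (M ** X ** N))"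
proof -
  interpret mat_mult: bounded_bilinear
    "(**) :: real^('s \<times> 'n)^('s \<times> 'n) \<Rightarrow> real^('s \<times> 'n)^('s \<times> 'n) \<Rightarrow> real^('s \<times> 'n)^('s \<times> 'n)"
    by (rule bounded_bilinear_matrix_matrix_mult)
  have "stage_map a B h X = X + h *\<^sub>R (X ** N) - h *\<^sub>R (M ** X) - (h * h) *\<^sub>R (M ** X ** N)"
    by (simp add: stage_map_def M_def[symmetric] N_def[symmetric] mat_mult.add_left mat_mult.add_right
        mat_mult.diff_left mat_mult.diff_right mat_mult.scaleR_left mat_mult.scaleR_right algebra_simps)
  then show ?thesis
    by (simp add: stage_iteration_def stage_residual_def algebra_simps)
qed

theorem proposition2:
  fixes a :: "real^'s^'s" and b :: "real^'s"
    and W0 :: "real^'n^'n" and B :: "real^'n^'n \<Rightarrow> real^'n^'n"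
    and \<epsilon> :: real and V :: "(real^('s::finite \<times> 'n::finite)^('s \<times> 'n)) set"
  assumes "symplectic_rk a b"
    and "linear B"
    and "\<epsilon> > 0"
    and "open V" and "block_W W0 \<in> V"
    and "\<And>h. h \<in> {-\<epsilon><..<\<epsilon>} \<Longrightarrow> \<exists>!X. X \<in> V \<and> block_W W0 = stage_map a B h X"
  shows "\<exists>\<delta>. 0 < \<delta> \<and> \<delta> \<le> \<epsilon> \<and>
    (\<forall>h. \<bar>h\<bar> < \<delta> \<longrightarrow>
      (\<exists>U. open U \<and> block_W W0 \<in> U \<and> U \<subseteq> V \<and> contraction_on U (stage_iteration a B W0 h)) \<and>
      (\<exists>X. (\<lambda>k. (stage_iteration a B W0 h ^^ k) (block_W W0)) \<longlonglongrightarrow> X \<and>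
           block_W W0 = stage_map a B h X))"
proof -
  let ?w = "block_W W0 :: real^('s \<times> 'n)^('s \<times> 'n)"
  let ?A = "block_A a :: real^('s \<times> 'n)^('s \<times> 'n)"
  obtain r where r: "r > 0" "cball ?w r \<subseteq> V"
    using assms(4,5) open_contains_cball by blast
  define P where "P X = ?A ** block_B B X ** X - X ** (block_B B X ** transpose ?A)" for X
  define Q where "Q X = ?A ** block_B B X ** X ** (block_B B X ** transpose ?A)" for X
  have C: "stage_iteration a B W0 h = (\<lambda>X. ?w + h *\<^sub>R (P X + h *\<^sub>R Q X))" for h
    by (rule ext) (simp add: stage_iteration_expand P_def Q_def)
  have lip_mult: "\<exists>L. L-lipschitz_on (cball ?w r) (\<lambda>X. f X ** g X)"
    if "\<exists>L. L-lipschitz_on (cball ?w r) f" "\<exists>L. L-lipschitz_on (cball ?w r) g"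
    for f g :: "real^('s \<times> 'n)^('s \<times> 'n) \<Rightarrow> real^('s \<times> 'n)^('s \<times> 'n)"
    using bounded_bilinear_lipschitz_on_bounded[OF bounded_bilinear_matrix_matrix_mult bounded_cball that] .
  have lip_B: "\<exists>L. L-lipschitz_on (cball ?w r) (block_B B)"
    using linear_block_B[OF assms(2)] bounded_linear.lipschitz_boundE
    by (metis linear_conv_bounded_linear)
  have lip_const: "\<exists>L. L-lipschitz_on (cball ?w r) (\<lambda>_. D)"
    and lip_id: "\<exists>L. L-lipschitz_on (cball ?w r) (\<lambda>X. X)"
    for D :: "real^('s \<times> 'n)^('s \<times> 'n)"
    using lipschitz_on_constant lipschitz_on_id by blast+
  have lip_P: "\<exists>L. L-lipschitz_on (cball ?w r) P"
  proof -
    have "\<exists>L. L-lipschitz_on (cball ?w r) (\<lambda>X. ?A ** block_B B X ** X)"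
      and "\<exists>L. L-lipschitz_on (cball ?w r) (\<lambda>X. X ** (block_B B X ** transpose ?A))"
      by (intro lip_mult lip_B lip_const lip_id)+
    then show ?thesis
      unfolding P_def using lipschitz_on_diff by blast
  qed
  have lip_Q: "\<exists>L. L-lipschitz_on (cball ?w r) Q"
    unfolding Q_def by (intro lip_mult lip_B lip_const lip_id)
  obtain \<delta> where \<delta>: "\<delta> > 0" and contr:
    "\<And>h. \<bar>h\<bar> < \<delta> \<Longrightarrow> (1/2)-lipschitz_on (cball ?w r) (stage_iteration a B W0 h)"
    "\<And>h. \<bar>h\<bar> < \<delta> \<Longrightarrow> stage_iteration a B W0 h ` cball ?w r \<subseteq> cball ?w r"
    unfolding C using small_perturbation_of_constant[OF r(1) lip_P lip_Q] by blast
  show ?thesis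
  proof (intro exI[of _ "min \<delta> \<epsilon>"] conjI allI impI)
    fix h assume "\<bar>h\<bar> < min \<delta> \<epsilon>"
    then have h: "\<bar>h\<bar> < \<delta>" by simp
    have "contraction_on (ball ?w r) (stage_iteration a B W0 h)"
      unfolding contraction_on_def
      using lipschitz_on_subset[OF contr(1)[OF h] ball_subset_cball]
      by (intro exI[of _ "1/2"]) simp
    then show "\<exists>U. open U \<and> ?w \<in> U \<and> U \<subseteq> V \<and> contraction_on U (stage_iteration a B W0 h)"
      using r ball_subset_cball by (intro exI[of _ "ball ?w r"]) auto
    have "complete (cball ?w r)" and "?w \<in> cball ?w r"
      using r(1) by (auto simp: complete_eq_closed)
    then obtain X where "stage_iteration a B W0 h X = X"
      and lim: "(\<lambda>k. (stage_iteration a B W0 h ^^ k) ?w) \<longlonglongrightarrow> X"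
      using contraction_iterates_converge[OF _ _ contr(2)[OF h] contr(1)[OF h], of ?w] by auto
    then have "?w = stage_map a B h X"
      by (simp add: stage_iteration_def stage_residual_def)
    with lim show "\<exists>X. (\<lambda>k. (stage_iteration a B W0 h ^^ k) ?w) \<longlonglongrightarrow> X \<and> ?w = stage_map a B h X"
      by blast
  qed (use \<delta> assms(3) in auto)
qed

end
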